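(* Let $d_b, L, k, E, G, C$ be positive integers with $E\,G = d_b L$, put $V = k^G$ and $D_e = E\,V$, and let bucketing functions $B_1,\dots,B_L:\mathbb{R}\to\{0,\dots,k-1\}$ and a fixed permutation $P$ of $d_bL$ coordinates be given. For embedding matrices $W_1,\dots,W_E\in\mathbb{R}^{V\times C}$ let $f_{NL}:\mathbb{R}^{d_b}\to\mathbb{R}^{C}$ be the associated non-linear SAFLe model, let $\Phi:\mathbb{R}^{d_b}\to\{0,1\}^{D_e}$ be the associated sparse feature map (which does not depend on $W_1,\dots,W_E$), and let $W_{global}\in\mathbb{R}^{D_e\times C}$ be the matrix obtained by vertically stacking $W_1,\dots,W_E$ (all as defined in the context). Then the non-linear model $f_{NL}$ is equivalent to the linear regressor with weight matrix $W_{global}$ in the feature space of $\Phi$: for all $W_1,\dots,W_E\in\mathbb{R}^{V\times C}$ and all $x\in\mathbb{R}^{d_b}$, $$ f_{NL}(x) = \Phi(x)^T W_{global}, $$ where outputs in $\mathbb{R}^C$ are regarded as row vectors.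
   Context: The SAFLe model $f_{NL}$ with parameters $W_1,\dots,W_E\in\mathbb{R}^{V\times C}$ is defined as follows. The rows of each $W_j$ are indexed by $\{0,\dots,V-1\}$, and $W_j[i,:]$ denotes the row of $W_j$ with index $i$. (1) Bucketing: for $x=(x_1,\dots,x_{d_b})\in\mathbb{R}^{d_b}$ set $d_q=d_bL$ and $b = [B_1(x_1),\dots,B_L(x_1),\dots,B_1(x_{d_b}),\dots,B_L(x_{d_b})]\in\{0,\dots,k-1\}^{d_q}$. (2) Shuffling and grouping: let $b'=P(b)$ be the vector $b$ with coordinates permuted by $P$, and partition $b'$ into $E$ consecutive groups $g_1,\dots,g_E$ of $G$ entries each, $g_j=[g_{j,1},\dots,g_{j,G}]$. (3) Embedding and summation: for $j=1,\dots,E$ set $idx_j = idx_j(x)=\sum_{i=1}^{G} g_{j,i}\,k^{i-1}\in\{0,\dots,V-1\}$, and define $f_{NL}(x)=\sum_{j=1}^{E} W_j[idx_j,:]$. The sparse feature map: $\phi_j(x)\in\{0,1\}^V$ is the one-hot (column) vector whose only non-zero entry, equal to $1$, is at position $idx_j(x)$, and $\Phi(x)=[\phi_1(x)^T\,|\,\phi_2(x)^T\,|\,\cdots\,|\,\phi_E(x)^T]^T\in\{0,1\}^{D_e}$ is the concatenation of $\phi_1(x),\dots,\phi_E(x)$. The global weight matrix is $W_{global}=\begin{pmatrix}W_1\\ \vdots\\ W_E\end{pmatrix}\in\mathbb{R}^{D_e\times C}$. *)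

theory Defs
  imports "Jordan_Normal_Form.Matrix" "HOL-Combinatorics.Permutations"
begin

text \<open>All coordinates, buckets, groups and embedding matrices are indexed from 0:
  \<open>B l\<close>, \<open>g j\<close>, \<open>W j\<close> stand for the conventional \<open>B\<^sub>l\<^sub>+\<^sub>1\<close>, \<open>g\<^sub>j\<^sub>+\<^sub>1\<close>, \<open>W\<^sub>j\<^sub>+\<^sub>1\<close>.
  The parameters are \<open>d\<close> (input dimension), \<open>L\<close> (bucketing functions per input coordinate),
  \<open>k\<close> (number of buckets), \<open>E\<close> (number of groups), \<open>G\<close> (group size), \<open>C\<close> (output dimension),
  the bucketing functions \<open>B\<close> and the permutation \<open>P\<close>.\<close>

definition bucket_vec :: "nat \<Rightarrow> nat \<Rightarrow> (nat \<Rightarrow> real \<Rightarrow> nat) \<Rightarrow> real vec \<Rightarrow> nat vec" where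
  "bucket_vec d L B x =
     vec_of_list (concat (map (\<lambda>i. map (\<lambda>l. B l (x $ i)) [0..<L]) [0..<d]))"

definition shuffle_vec :: "(nat \<Rightarrow> nat) \<Rightarrow> 'a vec \<Rightarrow> 'a vec" where
  "shuffle_vec P b = vec (dim_vec b) (\<lambda>i. b $ P i)"

definition group_vec :: "nat \<Rightarrow> 'a vec \<Rightarrow> nat \<Rightarrow> 'a vec" where
  "group_vec G b' j = vec G (\<lambda>i. b' $ (j * G + i))"

text \<open>The exponent is \<open>i\<close> rather than \<open>i - 1\<close> because of the indexing from 0.\<close>

definition safle_idx ::
  "nat \<Rightarrow> nat \<Rightarrow> nat \<Rightarrow> nat \<Rightarrow> (nat \<Rightarrow> real \<Rightarrow> nat) \<Rightarrow> (nat \<Rightarrow> nat) \<Rightarrow> nat \<Rightarrow> real vec \<Rightarrow> nat" where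
  "safle_idx d L k G B P j x =
     (let g = group_vec G (shuffle_vec P (bucket_vec d L B x)) j
      in \<Sum>i<G. g $ i * k ^ i)"

definition safle ::
  "nat \<Rightarrow> nat \<Rightarrow> nat \<Rightarrow> nat \<Rightarrow> nat \<Rightarrow> nat \<Rightarrow> (nat \<Rightarrow> real \<Rightarrow> nat) \<Rightarrow> (nat \<Rightarrow> nat) \<Rightarrow>
   (nat \<Rightarrow> real mat) \<Rightarrow> real vec \<Rightarrow> real vec" where
  "safle d L k E G C B P W x =
     finsum_vec TYPE(real) C (\<lambda>j. row (W j) (safle_idx d L k G B P j x)) {..<E}"

definition safle_onehot ::
  "nat \<Rightarrow> nat \<Rightarrow> nat \<Rightarrow> nat \<Rightarrow> (nat \<Rightarrow> real \<Rightarrow> nat) \<Rightarrow> (nat \<Rightarrow> nat) \<Rightarrow> nat \<Rightarrow> real vec \<Rightarrow> real vec" where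
  "safle_onehot d L k G B P j x = unit_vec (k ^ G) (safle_idx d L k G B P j x)"

definition safle_features ::
  "nat \<Rightarrow> nat \<Rightarrow> nat \<Rightarrow> nat \<Rightarrow> nat \<Rightarrow> (nat \<Rightarrow> real \<Rightarrow> nat) \<Rightarrow> (nat \<Rightarrow> nat) \<Rightarrow> real vec \<Rightarrow> real vec" where
  "safle_features d L k E G B P x =
     foldr (@\<^sub>v) (map (\<lambda>j. safle_onehot d L k G B P j x) [0..<E]) vNil"

text \<open>The empty matrix \<open>0\<^sub>m 0 C\<close> only terminates the stacking; it contributes no row.\<close>

definition global_weights :: "nat \<Rightarrow> nat \<Rightarrow> (nat \<Rightarrow> real mat) \<Rightarrow> real mat" where
  "global_weights E C W = foldr (@\<^sub>r) (map W [0..<E]) (0\<^sub>m 0 C)"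

text \<open>The remaining facts confirm that these objects have the intended ranges and dimensions.\<close>

lemma bucket_vec_dim: "dim_vec (bucket_vec d L B x) = d * L"
  by (simp add: bucket_vec_def length_concat o_def sum_list_triv)

lemma bucket_vec_less:
  assumes "\<And>l t. l < L \<Longrightarrow> B l t < k" and "n < d * L"
  shows "bucket_vec d L B x $ n < k"
proof -
  let ?xs = "concat (map (\<lambda>i. map (\<lambda>l. B l (x $ i)) [0..<L]) [0..<d])"
  have "length ?xs = d * L"
    by (simp add: length_concat o_def sum_list_triv)
  then have "?xs ! n \<in> set ?xs"
    using assms(2) by (metis nth_mem)
  then show ?thesis
    using assms(1) by (auto simp: bucket_vec_def vec_of_list_index)
qed

lemma base_expansion_less:
  fixes a :: "nat \<Rightarrow> nat"
  assumes "\<And>i. i < G \<Longrightarrow> a i < k"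
  shows "(\<Sum>i<G. a i * k ^ i) < k ^ G"
  using assms
proof (induction G)
  case (Suc G)
  have "(\<Sum>i<Suc G. a i * k ^ i) < k ^ G + a G * k ^ G"
    using Suc by simp
  also have "\<dots> = Suc (a G) * k ^ G" by simp
  also have "\<dots> \<le> k * k ^ G"
    using Suc.prems[of G] by (intro mult_right_mono) auto
  finally show ?case by simp
qed simp

lemma safle_idx_less:
  assumes "\<And>l t. l < L \<Longrightarrow> B l t < k" and "P permutes {..<d * L}"
    and "E * G = d * L" and "j < E"
  shows "safle_idx d L k G B P j x < k ^ G"
proof -
  have "group_vec G (shuffle_vec P (bucket_vec d L B x)) j $ i < k" if "i < G" for i
  proof -
    have "j * G + i < Suc j * G" using that by simp
    also have "\<dots> \<le> E * G" using assms(4) by (intro mult_right_mono) auto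
    finally have n: "j * G + i < d * L" using assms(3) by simp
    then have "P (j * G + i) < d * L"
      using permutes_in_image[OF assms(2), of "j * G + i"] by simp
    then have "bucket_vec d L B x $ P (j * G + i) < k"
      using assms(1) by (intro bucket_vec_less) auto
    then show ?thesis
      using that n by (simp add: group_vec_def shuffle_vec_def bucket_vec_dim)
  qed
  then show ?thesis
    unfolding safle_idx_def Let_def by (rule base_expansion_less)
qed

lemma safle_features_carrier:
  "safle_features d L k E G B P x \<in> carrier_vec (E * k ^ G)"
proof -
  have "dim_vec (foldr (@\<^sub>v) (map (\<lambda>j. safle_onehot d L k G B P j x) js) vNil)
          = length js * k ^ G" for js
    by (induction js) (simp_all add: safle_onehot_def)
  from this[of "[0..<E]"] show ?thesis
    by (intro carrier_vecI) (simp add: safle_features_def)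
qed

lemma global_weights_carrier:
  assumes "\<And>j. j < E \<Longrightarrow> W j \<in> carrier_mat V C"
  shows "global_weights E C W \<in> carrier_mat (E * V) C"
proof -
  have "foldr (@\<^sub>r) (map W js) (0\<^sub>m 0 C) \<in> carrier_mat (length js * V) C"
    if "\<And>j. j \<in> set js \<Longrightarrow> W j \<in> carrier_mat V C" for js
    using that by (induction js) auto
  from this[of "[0..<E]"] show ?thesis using assms by (simp add: global_weights_def)
qed

end

theory Submission
  imports Defs
begin

text \<open>Selecting a row of a matrix is left multiplication by a unit vector: entry
  \<open>c\<close> of row \<open>idx_j\<close> of \<open>W_j\<close> is the scalar product of the
  one-hot vector at \<open>idx_j\<close> with column \<open>c\<close> of \<open>W_j\<close>. Each
  column of the stacked matrix is the concatenation of the columns of the blocks, cut at the same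
  places as the feature vector. Its scalar product with the features therefore splits into one such
  term per block (\<open>scalar_prod_col_stacked\<close>), and the sum of these terms is the model's
  output.\<close>

text \<open>Row stacking is a four-block matrix whose right blocks have width 0, so only the two
  left blocks contribute to a column.\<close>

lemma col_append_rows:
  assumes "A \<in> carrier_mat m C" and "A' \<in> carrier_mat n C" and "c < C"
  shows "col (A @\<^sub>r A') c = col A c @\<^sub>v col A' c"
  using assms by (intro eq_vecI) (auto simp: append_rows_def)

lemma stacked_rows_carrier:
  assumes "\<And>j. j \<in> set js \<Longrightarrow> W j \<in> carrier_mat V C"
  shows "foldr (@\<^sub>r) (map W js) (0\<^sub>m 0 C) \<in> carrier_mat (length js * V) C"
  using assms by (induction js) auto

lemma concat_vec_carrier:
  assumes "\<And>j. j \<in> set js \<Longrightarrow> u j \<in> carrier_vec V"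
  shows "foldr (@\<^sub>v) (map u js) vNil \<in> carrier_vec (length js * V)"
  using assms by (induction js) auto

text \<open>Block multiplication for arbitrary blocks \<open>u j\<close>, stated over an arbitrary
  list so that induction can peel off one block at a time.\<close>

lemma scalar_prod_col_stacked:
  assumes "\<And>j. j \<in> set js \<Longrightarrow> u j \<in> carrier_vec V"
    and "\<And>j. j \<in> set js \<Longrightarrow> W j \<in> carrier_mat V C"
    and "c < C"
  shows "foldr (@\<^sub>v) (map u js) vNil \<bullet> col (foldr (@\<^sub>r) (map W js) (0\<^sub>m 0 C)) c
           = (\<Sum>j\<leftarrow>js. u j \<bullet> col (W j) c)"
  using assms(1,2)
proof (induction js)
  case Nil
  \<comment> \<open>The scalar product sums over the dimension of its right argument, here a column
    of a matrix without rows, so the sum is empty.\<close>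
  show ?case by (simp add: scalar_prod_def)
next
  case (Cons a js)
  have W: "foldr (@\<^sub>r) (map W js) (0\<^sub>m 0 C) \<in> carrier_mat (length js * V) C"
    using Cons.prems by (intro stacked_rows_carrier) auto
  have u: "foldr (@\<^sub>v) (map u js) vNil \<in> carrier_vec (length js * V)"
    using Cons.prems by (intro concat_vec_carrier) auto
  have Wa: "W a \<in> carrier_mat V C" and ua: "u a \<in> carrier_vec V"
    using Cons.prems by auto
  show ?case
    \<comment> \<open>The head blocks \<open>u a\<close> and \<open>W a\<close> share the dimension
      \<open>V\<close>, so the scalar product splits exactly at their boundary.\<close>
    using Cons
    by (simp add: col_append_rows[OF Wa W assms(3)]
        scalar_prod_append[OF ua u col_carrier_vec[OF assms(3) Wa] col_carrier_vec[OF assms(3) W]])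
qed

theorem lemma1:
  fixes d L k E G C :: nat
    and B :: "nat \<Rightarrow> real \<Rightarrow> nat"
    and P :: "nat \<Rightarrow> nat"
  assumes "0 < d" and "0 < L" and "0 < k" and "0 < E" and "0 < G" and "0 < C"
    and "E * G = d * L"
    and "\<And>l t. l < L \<Longrightarrow> B l t < k"
    and "P permutes {..<d * L}"
  shows "\<forall>W. (\<forall>j<E. W j \<in> carrier_mat (k ^ G) C) \<longrightarrow>
           (\<forall>x\<in>carrier_vec d.
              mat_of_row (safle d L k E G C B P W x)
                = mat_of_row (safle_features d L k E G B P x) * global_weights E C W)"
proof (intro allI impI ballI)
  fix W :: "nat \<Rightarrow> real mat" and x :: "real vec"
  assume W: "\<forall>j<E. W j \<in> carrier_mat (k ^ G) C"
  let ?i = "\<lambda>j. safle_idx d L k G B P j x"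
  have i: "?i j < k ^ G" if "j < E" for j
    using assms(7-9) that by (intro safle_idx_less) auto
  have rows: "(\<lambda>j. row (W j) (?i j)) \<in> {..<E} \<rightarrow> carrier_vec C"
    using W by (auto intro!: carrier_vecI)
  have gw: "global_weights E C W \<in> carrier_mat (E * k ^ G) C"
    using W by (intro global_weights_carrier) auto
  have sf: "safle d L k E G C B P W x \<in> carrier_vec C"
    unfolding safle_def by (rule finsum_vec_closed[OF rows])
  have entry: "safle d L k E G C B P W x $ c
      = safle_features d L k E G B P x \<bullet> col (global_weights E C W) c" if c: "c < C" for c
  proof -
    have "safle d L k E G C B P W x $ c = (\<Sum>j<E. row (W j) (?i j) $ c)"
      unfolding safle_def by (rule index_finsum_vec[OF _ c rows]) simp
    also have "\<dots> = (\<Sum>j<E. safle_onehot d L k G B P j x \<bullet> col (W j) c)"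
    proof (rule sum.cong)
      fix j assume "j \<in> {..<E}"
      \<comment> \<open>Both sides are the entry of \<open>W j\<close> at \<open>(?i j, c)\<close>;
        the bound \<open>i\<close> ensures that this position lies inside the matrix.\<close>
      then show "row (W j) (?i j) $ c = safle_onehot d L k G B P j x \<bullet> col (W j) c"
        using W i[of j] c
        by (auto simp: safle_onehot_def scalar_prod_left_unit[OF col_carrier_vec[OF c]])
    qed simp
    also have "\<dots> = (\<Sum>j\<leftarrow>[0..<E]. safle_onehot d L k G B P j x \<bullet> col (W j) c)"
      by (simp add: interv_sum_list_conv_sum_set_nat atLeast0LessThan)
    also have "\<dots> = safle_features d L k E G B P x \<bullet> col (global_weights E C W) c"
      unfolding safle_features_def global_weights_def
      using W c
      by (intro scalar_prod_col_stacked[where V = "k ^ G", symmetric]) (auto simp: safle_onehot_def)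
    finally show ?thesis .
  qed
  show "mat_of_row (safle d L k E G C B P W x)
      = mat_of_row (safle_features d L k E G B P x) * global_weights E C W"
    \<comment> \<open>Both sides have a single row, and its entries are compared by
      \<open>entry\<close>.\<close>
    using sf gw entry by (intro eq_matI) auto
qed

end
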